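(* For every integer $n\ge 0$, the number $E(n)$ of eight-vertex model configurations on the two-dimensional Sierpinski gasket $SG(n)$ is $$E(n)=2^{3(3^n+1)/2},$$ and the entropy per site $S_{E,SG}=\lim_{n\to\infty}\frac{\ln E(n)}{v(SG(n))}$, where $v(SG(n))=\frac32(3^n+1)$ is the number of vertices of $SG(n)$, equals $\ln 2$.
   Context: The two-dimensional Sierpinski gasket graphs $SG(n)$, $n\ge 0$, are defined recursively. $SG(0)$ is a triangle (three vertices, three edges), drawn as an equilateral triangle, with all three vertices called outmost. $SG(n+1)$ is obtained by subdividing a larger equilateral triangle into four congruent equilateral triangles, placing a copy of $SG(n)$ in each of the three corner triangles (bottom left, bottom right, top; not in the middle one), and identifying the outmost vertices of different copies that coincide (each pair of copies shares exactly one vertex). The outmost vertices of $SG(n+1)$ are the three corners of the large triangle. $SG(n)$ has $3^{n+1}$ edges and $\frac32(3^n+1)$ vertices; the three outmost vertices have degree 2 and all others have degree 4. An eight-vertex model configuration on $SG(n)$ is an assignment of an orientation to every edge such that at every vertex of degree 4 the number of incident edges pointing toward the vertex is even (0, 2 or 4). No condition is imposed at the three outmost vertices. $E(n)$ is the number of such configurations. *)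

theory Defs
  imports Complex_Main "HOL-Library.FuncSet" "HOL-Library.Product_Plus"
begin

text \<open>
  The gasket graphs are drawn in the triangular lattice. The pair \<open>(i, j)\<close> stands for the
  point \<open>i a + j b\<close>, where \<open>a\<close> and \<open>b\<close> are unit vectors at an angle of 60 degrees, so that the
  corners of \<open>SG(n)\<close> are \<open>(0, 0)\<close>, \<open>(2 ^ n, 0)\<close> and \<open>(0, 2 ^ n)\<close>. The three copies of \<open>SG(n)\<close> in
  \<open>SG(n + 1)\<close> are translates, and outmost vertices of different copies that coincide are
  identified because they have the same coordinates. The lemmas \<open>sg_copies_meet\<close> below show
  that nothing else is identified.
\<close>

fun sg_verts :: "nat \<Rightarrow> (nat \<times> nat) set" where
  "sg_verts 0 = {(0, 0), (1, 0), (0, 1)}"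
| "sg_verts (Suc n) = sg_verts n \<union> (+) (2 ^ n, 0) ` sg_verts n \<union> (+) (0, 2 ^ n) ` sg_verts n"

text \<open>An edge is the set of its two endpoints.\<close>

fun sg_edges :: "nat \<Rightarrow> (nat \<times> nat) set set" where
  "sg_edges 0 = {{(0, 0), (1, 0)}, {(0, 0), (0, 1)}, {(1, 0), (0, 1)}}"
| "sg_edges (Suc n) =
     sg_edges n \<union> image ((+) (2 ^ n, 0)) ` sg_edges n \<union> image ((+) (0, 2 ^ n)) ` sg_edges n"

definition sg_outmost :: "nat \<Rightarrow> (nat \<times> nat) set" where
  "sg_outmost n = {(0, 0), (2 ^ n, 0), (0, 2 ^ n)}"

definition sg_degree :: "nat \<Rightarrow> nat \<times> nat \<Rightarrow> nat" where
  "sg_degree n v = card {e \<in> sg_edges n. v \<in> e}"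

text \<open>An orientation assigns to every edge the endpoint it points toward.\<close>

definition sg_orientations :: "nat \<Rightarrow> ((nat \<times> nat) set \<Rightarrow> nat \<times> nat) set" where
  "sg_orientations n = (\<Pi>\<^sub>E e \<in> sg_edges n. e)"

definition sg_indegree :: "nat \<Rightarrow> ((nat \<times> nat) set \<Rightarrow> nat \<times> nat) \<Rightarrow> nat \<times> nat \<Rightarrow> nat" where
  "sg_indegree n h v = card {e \<in> sg_edges n. v \<in> e \<and> h e = v}"

definition eight_vertex_configs :: "nat \<Rightarrow> ((nat \<times> nat) set \<Rightarrow> nat \<times> nat) set" where
  "eight_vertex_configs n =
     {h \<in> sg_orientations n. \<forall>v \<in> sg_verts n. sg_degree n v = 4 \<longrightarrow> even (sg_indegree n h v)}"

definition num_eight_vertex :: "nat \<Rightarrow> nat" where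
  "num_eight_vertex n = card (eight_vertex_configs n)"

lemma sg_outmost_subset: "sg_outmost n \<subseteq> sg_verts n"
proof (induction n)
  case 0
  show ?case by (simp add: sg_outmost_def)
next
  case (Suc n)
  have "(2 ^ n, 0) + (2 ^ n, 0) \<in> sg_verts (Suc n)" "(0, 2 ^ n) + (0, 2 ^ n) \<in> sg_verts (Suc n)"
    using Suc by (auto simp: sg_outmost_def simp del: add_Pair)
  moreover have "(0, 0) \<in> sg_verts (Suc n)"
    using Suc by (simp add: sg_outmost_def)
  ultimately show ?case
    by (simp add: sg_outmost_def mult_2 del: sg_verts.simps)
qed

lemma sg_verts_bound: "(i, j) \<in> sg_verts n \<Longrightarrow> i + j \<le> 2 ^ n"
proof (induction n arbitrary: i j)
  case 0
  then show ?case by auto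
next
  case (Suc n)
  from Suc.prems consider "(i, j) \<in> sg_verts n"
    | k l where "(k, l) \<in> sg_verts n" "i + j = 2 ^ n + (k + l)"
    by auto
  then show ?case
    by cases (auto dest: Suc.IH)
qed

lemma sg_copies_meet:
  "sg_verts n \<inter> (+) (2 ^ n, 0) ` sg_verts n = {(2 ^ n, 0)}"
  "sg_verts n \<inter> (+) (0, 2 ^ n) ` sg_verts n = {(0, 2 ^ n)}"
  "(+) (2 ^ n, 0) ` sg_verts n \<inter> (+) (0, 2 ^ n) ` sg_verts n = {(2 ^ n, 2 ^ n)}"
proof -
  have corners: "(0, 0) \<in> sg_verts n" "(2 ^ n, 0) \<in> sg_verts n" "(0, 2 ^ n) \<in> sg_verts n"
    using sg_outmost_subset[of n] by (auto simp: sg_outmost_def)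
  have mem1: "(2 ^ n, 0) + v \<in> (+) (2 ^ n, 0) ` sg_verts n"
    and mem2: "(0, 2 ^ n) + v \<in> (+) (0, 2 ^ n) ` sg_verts n" if "v \<in> sg_verts n" for v
    using that by blast+
  note mem = mem1[OF corners(1)] mem2[OF corners(1)] mem1[OF corners(3)] mem2[OF corners(2)]
  show "sg_verts n \<inter> (+) (2 ^ n, 0) ` sg_verts n = {(2 ^ n, 0)}"
  proof
    show "sg_verts n \<inter> (+) (2 ^ n, 0) ` sg_verts n \<subseteq> {(2 ^ n, 0)}"
      by (auto dest!: sg_verts_bound)
    show "{(2 ^ n, 0)} \<subseteq> sg_verts n \<inter> (+) (2 ^ n, 0) ` sg_verts n"
      using corners mem by simp
  qed
  show "sg_verts n \<inter> (+) (0, 2 ^ n) ` sg_verts n = {(0, 2 ^ n)}"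
  proof
    show "sg_verts n \<inter> (+) (0, 2 ^ n) ` sg_verts n \<subseteq> {(0, 2 ^ n)}"
      by (auto dest!: sg_verts_bound)
    show "{(0, 2 ^ n)} \<subseteq> sg_verts n \<inter> (+) (0, 2 ^ n) ` sg_verts n"
      using corners mem by simp
  qed
  show "(+) (2 ^ n, 0) ` sg_verts n \<inter> (+) (0, 2 ^ n) ` sg_verts n = {(2 ^ n, 2 ^ n)}"
  proof
    show "(+) (2 ^ n, 0) ` sg_verts n \<inter> (+) (0, 2 ^ n) ` sg_verts n \<subseteq> {(2 ^ n, 2 ^ n)}"
      by (auto dest!: sg_verts_bound)
    show "{(2 ^ n, 2 ^ n)} \<subseteq> (+) (2 ^ n, 0) ` sg_verts n \<inter> (+) (0, 2 ^ n) ` sg_verts n"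
      using mem by simp
  qed
qed

end

theory Submission
  imports Defs
begin

text \<open>
  If every constrained vertex \<open>v\<close> has an edge to a vertex of smaller rank, the parity conditions
  are independent: impose them in order of decreasing rank. Reversing the edge from \<open>v\<close> downwards
  changes the parity at \<open>v\<close> and at no vertex treated before, so each condition halves the number
  of orientations. In the gasket, ranked by \<open>i + j\<close>, every vertex but the origin has such an edge,
  and \<open>3 ^ (n + 1)\<close> edges with \<open>3 (3 ^ n - 1) / 2\<close> conditions leave \<open>2 ^ (3 (3 ^ n + 1) / 2)\<close>
  configurations.
\<close>

section \<open>Orientations of an arbitrary graph under parity conditions\<close>

definition even_orientations :: "'a set set \<Rightarrow> 'a set \<Rightarrow> ('a set \<Rightarrow> 'a) set" where
  "even_orientations E T = {h \<in> (\<Pi>\<^sub>E e \<in> E. e). \<forall>v \<in> T. even (card {e \<in> E. v \<in> e \<and> h e = v})}"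

text \<open>Reversing the edge \<open>{v, p}\<close> is an involution on the orientations that are
  even on \<open>T\<close>: neither endpoint lies in \<open>T\<close>, so no condition there is
  touched. The parity at \<open>v\<close> changes, so orientations even at \<open>v\<close> are
  matched with those odd at \<open>v\<close>.\<close>

lemma card_even_orientations_insert:
  assumes fin: "finite E" and fine: "\<And>e. e \<in> E \<Longrightarrow> finite e"
    and edge: "{v, p} \<in> E" and p: "p \<noteq> v" "p \<notin> T" and v: "v \<notin> T"
  shows "card (even_orientations E T) = 2 * card (even_orientations E (insert v T))"
proof -
  define ind where "ind h w = {e \<in> E. w \<in> e \<and> h e = w}" for h :: "'a set \<Rightarrow> 'a" and w
  define flip where "flip h = h({v, p} := if h {v, p} = v then p else v)" for h :: "'a set \<Rightarrow> 'a"
  let ?A = "even_orientations E T"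
  let ?B = "even_orientations E (insert v T)"
  have finA: "finite ?A"
    by (rule finite_subset[of _ "\<Pi>\<^sub>E e \<in> E. e"])
      (auto simp: even_orientations_def intro: finite_PiE fin fine)
  have A: "h \<in> ?A \<longleftrightarrow> h \<in> (\<Pi>\<^sub>E e \<in> E. e) \<and> (\<forall>w \<in> T. even (card (ind h w)))" for h
    by (simp add: even_orientations_def ind_def)
  have B: "h \<in> ?B \<longleftrightarrow> h \<in> ?A \<and> even (card (ind h v))" for h
    by (auto simp: even_orientations_def ind_def)
  have flip_other: "ind (flip h) w = ind h w" if "w \<in> T" for h w
  proof -
    have "w \<noteq> v" "w \<noteq> p" using that p v by auto
    then show ?thesis by (auto simp: ind_def flip_def)
  qed
  have flip_v: "even (card (ind (flip h) v)) \<longleftrightarrow> odd (card (ind h v))" for h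
  proof -
    have fin': "finite (ind h v)" for h using fin by (simp add: ind_def)
    show ?thesis
    proof (cases "h {v, p} = v")
      case True
      then have "ind h v = insert {v, p} (ind (flip h) v)" "{v, p} \<notin> ind (flip h) v"
        using edge p by (auto simp: ind_def flip_def)
      then show ?thesis by (simp add: fin')
    next
      case False
      then have "ind (flip h) v = insert {v, p} (ind h v)" "{v, p} \<notin> ind h v"
        using edge p by (auto simp: ind_def flip_def)
      then show ?thesis by (simp add: fin')
    qed
  qed
  have flip_A: "flip h \<in> ?A" if "h \<in> ?A" for h
  proof -
    have "flip h \<in> (\<Pi>\<^sub>E e \<in> E. e)"
      using that edge unfolding A flip_def by (auto simp: PiE_iff extensional_def)
    then show ?thesis using that by (simp add: A flip_other)
  qed
  \<comment> \<open>Membership in \<open>?A\<close> matters: if \<open>h {v, p}\<close> were not an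
    endpoint of the edge, two flips would not restore it.\<close>
  have flip_flip: "flip (flip h) = h" if "h \<in> ?A" for h
  proof -
    have "h {v, p} \<in> {v, p}" using that edge unfolding A by (blast dest: PiE_mem)
    then show ?thesis using p by (auto simp: flip_def)
  qed
  have "bij_betw flip ?B (?A - ?B)"
    by (rule bij_betw_byWitness[where f' = flip])
      (auto simp: B flip_A flip_flip flip_v)
  then have "card ?B = card (?A - ?B)"
    by (rule bij_betw_same_card)
  moreover have "?B \<subseteq> ?A" using B by auto
  ultimately show ?thesis
    using finA by (metis card_Diff_subset card_mono finite_subset le_add_diff_inverse mult_2)
qed

lemma card_even_orientations:
  fixes rank :: "'a \<Rightarrow> nat"
  assumes fin: "finite E" "finite T" and edges: "\<And>e. e \<in> E \<Longrightarrow> card e = 2"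
    and down: "\<And>v. v \<in> T \<Longrightarrow> \<exists>p. rank p < rank v \<and> {v, p} \<in> E"
  shows "2 ^ card T * card (even_orientations E T) = 2 ^ card E"
  using fin(2) down
\<comment> \<open>The rule inserts an element with the largest \<open>f\<close>; negating the rank
  makes \<open>v\<close> of least rank, so its lower neighbour \<open>p\<close> is outside
  \<open>T\<close>. The rule does not ensure that \<open>v\<close> is new, hence the case split on
  \<open>v \<in> T\<close> at the end.\<close>
proof (induction T rule: finite_ranking_induct[where f = "\<lambda>v. - int (rank v)"])
  case empty
  then show ?case
    using fin(1) edges by (simp add: even_orientations_def card_PiE)
next
  case (insert v T)
  from insert.prems[of v] obtain p where p: "rank p < rank v" "{v, p} \<in> E" by auto
  have "finite e" if "e \<in> E" for e using edges[OF that] card.infinite by fastforce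
  moreover have "p \<noteq> v" "p \<notin> T" using p insert.hyps(2) by force+
  ultimately have "v \<notin> T \<Longrightarrow> card (even_orientations E T) = 2 * card (even_orientations E (insert v T))"
    using card_even_orientations_insert[OF fin(1), of v p T] p by blast
  moreover have "2 ^ card T * card (even_orientations E T) = 2 ^ card E"
    using insert by blast
  ultimately show ?case
    using insert.hyps(1) by (cases "v \<in> T") (simp_all add: insert_absorb mult_ac)
qed

section \<open>Counting the edges and vertices of the gasket\<close>

lemma finite_sg_verts: "finite (sg_verts n)"
  by (induction n) auto

lemma finite_sg_edges: "finite (sg_edges n)"
  by (induction n) auto

lemma sg_edges_subset: "e \<in> sg_edges n \<Longrightarrow> e \<subseteq> sg_verts n"
proof (induction n arbitrary: e)
  case 0
  then show ?case by auto
next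
  case (Suc n)
  then show ?case by simp blast
qed

lemma card_sg_edge: "e \<in> sg_edges n \<Longrightarrow> card e = 2"
  by (induction n arbitrary: e) (auto simp: card_image simp del: add_Pair)

text \<open>An edge has two endpoints, whereas two copies have a single vertex in common.\<close>

lemma sg_edges_copies_disjoint:
  "sg_edges n \<inter> image ((+) (2 ^ n, 0)) ` sg_edges n = {}"
  "sg_edges n \<inter> image ((+) (0, 2 ^ n)) ` sg_edges n = {}"
  "image ((+) (2 ^ n, 0)) ` sg_edges n \<inter> image ((+) (0, 2 ^ n)) ` sg_edges n = {}"
proof -
  have disj: "X \<inter> Y = {}"
    if "\<And>e. e \<in> X \<Longrightarrow> e \<subseteq> A \<and> card e = 2" "\<And>e. e \<in> Y \<Longrightarrow> e \<subseteq> B" "A \<inter> B = {x}"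
    for X Y :: "(nat \<times> nat) set set" and A B x
  proof (rule ccontr)
    assume "X \<inter> Y \<noteq> {}"
    then obtain e where e: "e \<in> X" "e \<in> Y" by blast
    have "card e = 2" "e \<subseteq> {x}" using that(1)[OF e(1)] that(2)[OF e(2)] that(3) by blast+
    then show False using card_mono[of "{x}" e] by simp
  qed
  have orig: "e \<subseteq> sg_verts n \<and> card e = 2" if "e \<in> sg_edges n" for e
    using that sg_edges_subset card_sg_edge by blast
  have copy: "e \<subseteq> (+) s ` sg_verts n \<and> card e = 2"
    if "e \<in> image ((+) s) ` sg_edges n" for e s
    using that orig by (auto simp: card_image simp del: add_Pair)
  show "sg_edges n \<inter> image ((+) (2 ^ n, 0)) ` sg_edges n = {}"
    by (rule disj[OF _ _ sg_copies_meet(1)]) (use orig copy in blast)+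
  show "sg_edges n \<inter> image ((+) (0, 2 ^ n)) ` sg_edges n = {}"
    by (rule disj[OF _ _ sg_copies_meet(2)]) (use orig copy in blast)+
  show "image ((+) (2 ^ n, 0)) ` sg_edges n \<inter> image ((+) (0, 2 ^ n)) ` sg_edges n = {}"
    by (rule disj[OF _ _ sg_copies_meet(3)]) (use copy in blast)+
qed

lemma inj_image_plus: "inj (image ((+) (s :: nat \<times> nat)))"
  by (simp add: inj_image_eq_iff inj_on_def)

lemma card_sg_edges: "card (sg_edges n) = 3 ^ (n + 1)"
proof (induction n)
  case 0
  then show ?case by (simp add: doubleton_eq_iff)
next
  case (Suc n)
  have "card (image ((+) s) ` sg_edges n) = card (sg_edges n)" for s
    by (rule card_image[OF inj_on_subset[OF inj_image_plus]]) simp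
  then show ?case
    using Suc sg_edges_copies_disjoint[of n]
    by (simp add: card_Un_disjoint finite_sg_edges Int_Un_distrib2 del: add_Pair)
qed

lemma card_sg_verts: "2 * card (sg_verts n) = 3 * (3 ^ n + 1)"
proof (induction n)
  case 0
  then show ?case by simp
next
  case (Suc n)
  let ?V = "sg_verts n"
  let ?V1 = "(+) (2 ^ n, 0) ` ?V"
  let ?V2 = "(+) (0, 2 ^ n) ` ?V"
  have copy: "card ((+) s ` ?V) = card ?V" for s
    by (simp add: card_image)
  have "card ?V + card ?V1 = card (?V \<union> ?V1) + 1"
    using card_Un_Int[of ?V ?V1] by (simp add: finite_sg_verts sg_copies_meet)
  \<comment> \<open>The third copy meets the first two in different points,
    \<open>(0, 2 ^ n)\<close> and \<open>(2 ^ n, 2 ^ n)\<close>.\<close>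
  moreover have "card (?V \<union> ?V1) + card ?V2 = card (sg_verts (Suc n)) + 2"
    using card_Un_Int[of "?V \<union> ?V1" ?V2]
    by (simp add: finite_sg_verts sg_copies_meet Int_Un_distrib2)
  ultimately have "3 * card ?V = card (sg_verts (Suc n)) + 3"
    unfolding copy by linarith
  then show ?case using Suc by (simp del: sg_verts.simps)
qed

section \<open>Degrees and descending edges\<close>

lemma card_incident_copy:
  "card {e \<in> image ((+) (a, b)) ` sg_edges n. (i, j) \<in> e} =
    (if a \<le> i \<and> b \<le> j then sg_degree n (i - a, j - b) else 0)"
proof (cases "a \<le> i \<and> b \<le> j")
  case True
  have "{e \<in> image ((+) (a, b)) ` sg_edges n. (i, j) \<in> e} =
      image ((+) (a, b)) ` {e \<in> sg_edges n. (i - a, j - b) \<in> e}"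
    using True by force
  moreover have "card (image ((+) (a, b)) ` X) = card X" for X
    by (rule card_image[OF inj_on_subset[OF inj_image_plus]]) simp
  ultimately show ?thesis using True by (simp add: sg_degree_def)
next
  case False
  then have "{e \<in> image ((+) (a, b)) ` sg_edges n. (i, j) \<in> e} = {}"
    by auto
  then show ?thesis using False by (simp only: card.empty if_False)
qed

text \<open>Degrees add up because the three copies have disjoint edge sets. Subtraction on naturals
  truncates, so without the guards a point outside a translate could be mistaken for a point of
  it.\<close>

lemma sg_degree_Suc:
  "sg_degree (Suc n) (i, j) = sg_degree n (i, j) +
    (if 2 ^ n \<le> i then sg_degree n (i - 2 ^ n, j) else 0) +
    (if 2 ^ n \<le> j then sg_degree n (i, j - 2 ^ n) else 0)"
proof -
  let ?I = "\<lambda>X. {e \<in> X. (i, j) \<in> e}"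
  let ?E = "sg_edges n"
  let ?E1 = "image ((+) (2 ^ n, 0)) ` ?E"
  let ?E2 = "image ((+) (0, 2 ^ n)) ` ?E"
  have "?I (sg_edges (Suc n)) = ?I ?E \<union> ?I ?E1 \<union> ?I ?E2"
    by auto
  moreover have "card (?I ?E \<union> ?I ?E1 \<union> ?I ?E2) = card (?I ?E \<union> ?I ?E1) + card (?I ?E2)"
    using sg_edges_copies_disjoint[of n]
    by (intro card_Un_disjoint) (auto simp: finite_sg_edges simp del: add_Pair)
  moreover have "card (?I ?E \<union> ?I ?E1) = card (?I ?E) + card (?I ?E1)"
    using sg_edges_copies_disjoint[of n]
    by (intro card_Un_disjoint) (auto simp: finite_sg_edges simp del: add_Pair)
  ultimately show ?thesis
    by (simp add: card_incident_copy sg_degree_def[of "Suc n"] sg_degree_def[of n "(i, j)"])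
qed

lemma sg_verts_Suc_iff:
  "(i, j) \<in> sg_verts (Suc n) \<longleftrightarrow> (i, j) \<in> sg_verts n \<or>
    2 ^ n \<le> i \<and> (i - 2 ^ n, j) \<in> sg_verts n \<or> 2 ^ n \<le> j \<and> (i, j - 2 ^ n) \<in> sg_verts n"
  by (force simp: image_iff)

text \<open>A gluing point is outmost in exactly two copies and gets 2 + 2; every other vertex lies
  in one copy and keeps its degree. The value 0 off the graph belongs to the induction, since the
  recursion also evaluates degrees outside a copy. It follows that the condition on vertices of
  degree 4 concerns exactly the non-outmost ones.\<close>

lemma sg_degree_eq:
  "sg_degree n v = (if v \<in> sg_outmost n then 2 else if v \<in> sg_verts n then 4 else 0)"
proof (induction n arbitrary: v)
  case 0
  have "{e \<in> sg_edges 0. v \<in> e} = (if v = (0, 0) then {{(0, 0), (1, 0)}, {(0, 0), (0, 1)}}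
      else if v = (1, 0) then {{(0, 0), (1, 0)}, {(1, 0), (0, 1)}}
      else if v = (0, 1) then {{(0, 0), (0, 1)}, {(1, 0), (0, 1)}} else {})"
    by auto
  then show ?case
    by (auto simp: sg_degree_def sg_outmost_def doubleton_eq_iff)
next
  case (Suc n)
  obtain i j where v: "v = (i, j)" by (cases v)
  define N :: nat where "N = 2 ^ n"
  have N: "2 ^ n = N" "2 ^ Suc n = 2 * N" "N > 0" by (auto simp: N_def)
  have bound: "k + l \<le> N" if "(k, l) \<in> sg_verts n" for k l
    using sg_verts_bound[OF that] by (simp add: N_def)
  have corners: "(0, 0) \<in> sg_verts n" "(N, 0) \<in> sg_verts n" "(0, N) \<in> sg_verts n"
    using sg_outmost_subset[of n] by (auto simp: sg_outmost_def N_def)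
  \<comment> \<open>The position of \<open>i\<close> and \<open>j\<close> relative to
    \<open>N\<close> decides which translates can contain \<open>v\<close>. Writing a large
    coordinate as \<open>N + a\<close> or \<open>N + b\<close> removes the subtraction, and
    \<open>bound\<close> leaves only corners where copies overlap.\<close>
  show ?case
  proof (cases "N \<le> i")
    case True
    then obtain a where i: "i = N + a" by (auto simp: le_iff_add)
    show ?thesis
    proof (cases "N \<le> j")
      case True
      then obtain b where j: "j = N + b" by (auto simp: le_iff_add)
      show ?thesis
        unfolding v sg_degree_Suc Suc sg_verts_Suc_iff sg_outmost_def N i j
        using N(3) corners bound[of "N + a" "N + b"] bound[of a "N + b"] bound[of "N + a" b]
        by auto
    next
      case False
      then show ?thesis
        unfolding v sg_degree_Suc Suc sg_verts_Suc_iff sg_outmost_def N i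
        using N(3) corners bound[of "N + a" j] bound[of a j]
        by auto
    qed
  next
    case False
    show ?thesis
    proof (cases "N \<le> j")
      case True
      then obtain b where j: "j = N + b" by (auto simp: le_iff_add)
      show ?thesis
        unfolding v sg_degree_Suc Suc sg_verts_Suc_iff sg_outmost_def N j
        using False N(3) corners bound[of i "N + b"] bound[of i b]
        by auto
    next
      case False
      with \<open>\<not> N \<le> i\<close> show ?thesis
        unfolding v sg_degree_Suc Suc sg_verts_Suc_iff sg_outmost_def N
        by auto
    qed
  qed
qed

text \<open>Translation preserves rank differences, so a vertex of a shifted copy inherits the edge
  of its preimage, unless that preimage is the origin. In that case the vertex is a corner of the
  unshifted copy and the induction hypothesis applies to it directly.\<close>

lemma sg_edge_down:
  "v \<in> sg_verts n \<Longrightarrow> v \<noteq> (0, 0) \<Longrightarrow> \<exists>p. fst p + snd p < fst v + snd v \<and> {v, p} \<in> sg_edges n"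
proof (induction n arbitrary: v)
  case 0
  then show ?case by (auto simp: insert_commute)
next
  case (Suc n)
  have corners: "(2 ^ n, 0) \<in> sg_verts n" "(0, 2 ^ n) \<in> sg_verts n"
    using sg_outmost_subset[of n] by (auto simp: sg_outmost_def)
  consider "v \<in> sg_verts n"
    | s u where "s \<in> {(2 ^ n, 0), (0, 2 ^ n)}" "u \<in> sg_verts n" "u \<noteq> (0, 0)" "v = s + u"
  proof (cases "v \<in> sg_verts n")
    case False
    then obtain s u where su: "s \<in> {(2 ^ n, 0), (0, 2 ^ n)}" "u \<in> sg_verts n" "v = s + u"
      using Suc.prems(1) by (simp del: add_Pair) blast
    with False corners have "u \<noteq> (0, 0)" by auto
    with su show thesis using that(2) by blast
  qed
  then show ?case
  proof cases
    case 1
    then show ?thesis using Suc.IH[OF 1 Suc.prems(2)] by auto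
  next
    case 2
    then obtain p where p: "fst p + snd p < fst u + snd u" "{u, p} \<in> sg_edges n"
      using Suc.IH by blast
    then have "(+) s ` {u, p} \<in> sg_edges (Suc n)"
      using 2(1) unfolding sg_edges.simps by blast
    then show ?thesis
      using p 2 by (intro exI[of _ "s + p"]) auto
  qed
qed

section \<open>The number of configurations and the entropy\<close>

lemma card_sg_inner: "card (sg_verts n - sg_outmost n) + 3 = card (sg_verts n)"
proof -
  have "card (sg_outmost n) = 3" by (simp add: sg_outmost_def)
  then show ?thesis
    using sg_outmost_subset[of n] card_mono[OF finite_sg_verts, of "sg_outmost n" n]
    by (simp add: card_Diff_subset finite_subset[OF _ finite_sg_verts])
qed

text \<open>The exponent is the number of edges minus the number of inner vertices. With
  \<open>V\<close> vertices there are \<open>2 * V - 3\<close> edges and \<open>V - 3\<close> inner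
  vertices, so the difference is \<open>V\<close>.\<close>

lemma num_eight_vertex_eq: "num_eight_vertex n = 2 ^ card (sg_verts n)"
proof -
  let ?T = "sg_verts n - sg_outmost n"
  have "eight_vertex_configs n = even_orientations (sg_edges n) ?T"
    using sg_degree_eq[of n]
    by (auto simp: eight_vertex_configs_def even_orientations_def sg_orientations_def
        sg_indegree_def)
  moreover have "2 ^ card ?T * card (even_orientations (sg_edges n) ?T) = 2 ^ card (sg_edges n)"
  proof (rule card_even_orientations[where rank = "\<lambda>v. fst v + snd v"])
    fix v assume "v \<in> ?T"
    \<comment> \<open>The origin, which has no descending edge, is outmost and hence not in
      \<open>?T\<close>.\<close>
    then show "\<exists>p. fst p + snd p < fst v + snd v \<and> {v, p} \<in> sg_edges n"
      by (intro sg_edge_down) (auto simp: sg_outmost_def)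
  qed (simp_all add: finite_sg_edges finite_sg_verts card_sg_edge)
  ultimately have "2 ^ card ?T * num_eight_vertex n = 2 ^ card (sg_edges n)"
    by (simp add: num_eight_vertex_def)
  moreover have "card (sg_edges n) = card ?T + card (sg_verts n)"
    using card_sg_inner[of n] card_sg_verts[of n] card_sg_edges[of n] by simp
  ultimately show ?thesis by (simp add: power_add)
qed

theorem proposition4p1:
  shows "(\<forall>n. num_eight_vertex n = 2 ^ (3 * (3 ^ n + 1) div 2)) \<and>
    (\<forall>n. real (card (sg_verts n)) = 3 / 2 * (3 ^ n + 1)) \<and>
    (\<lambda>n. ln (real (num_eight_vertex n)) / real (card (sg_verts n))) \<longlonglongrightarrow> ln 2"
proof (intro conjI allI)
  fix n
  have "card (sg_verts n) = 3 * (3 ^ n + 1) div 2"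
    using card_sg_verts[of n] by linarith
  then show "num_eight_vertex n = 2 ^ (3 * (3 ^ n + 1) div 2)"
    by (simp add: num_eight_vertex_eq)
  have "2 * real (card (sg_verts n)) = 3 * (3 ^ n + 1)"
    using arg_cong[OF card_sg_verts[of n], of real] by simp
  then show "real (card (sg_verts n)) = 3 / 2 * (3 ^ n + 1)" by simp
next
  \<comment> \<open>The exponent equals the number of vertices, which is nonzero, so the sequence is
    constant.\<close>
  have "ln (real (num_eight_vertex n)) / real (card (sg_verts n)) = ln 2" for n
    using card_sg_verts[of n] by (auto simp: num_eight_vertex_eq ln_realpow)
  then show "(\<lambda>n. ln (real (num_eight_vertex n)) / real (card (sg_verts n))) \<longlonglongrightarrow> ln 2"
    by simp
qed

end
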